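(* Let $(X,\lVert\cdot\rVert_X)$ and $(Y,\lVert\cdot\rVert_Y)$ be quasi-Banach function spaces over $(R,\mu)$. If $X\subseteq Y$, then also $X\hookrightarrow Y$, i.e. the identity mapping $I:X\to Y$ is continuous.
   Context: $(R,\mu)$ is a $\sigma$-finite measure space. $M=M(R,\mu)$ is the set of all $\mu$-measurable functions $R\to\mathbb C\cup\{\infty\}$, functions equal $\mu$-a.e. being identified; $M_+$ is the subset of functions with values in $[0,\infty]$. A quasi-Banach function norm is a map $\lVert\cdot\rVert:M\to[0,\infty]$ with $\lVert\,|f|\,\rVert=\lVert f\rVert$ for all $f\in M$ whose restriction to $M_+$ satisfies: (Q1) (a) $\lVert af\rVert=|a|\lVert f\rVert$ for all $a\in\mathbb C$, $f\in M_+$ (with the usual convention $0\cdot\infty=0$); (b) $\lVert f\rVert=0$ iff $f=0$ $\mu$-a.e.; (c) there is a constant $C\ge1$ (the modulus of concavity) such that $\lVert f+g\rVert\le C(\lVert f\rVert+\lVert g\rVert)$ for all $f,g\in M_+$; (P2) if $f,g\in M_+$ and $f\le g$ $\mu$-a.e., then $\lVert f\rVert\le\lVert g\rVert$; (P3) if $f_n,f\in M_+$ and $f_n\uparrow f$ $\mu$-a.e., then $\lVert f_n\rVert\uparrow\lVert f\rVert$; (P4) $\lVert\chi_E\rVert<\infty$ for every measurable $E\subseteq R$ with $\mu(E)<\infty$. The corresponding quasi-Banach function space is $X=\{f\in M:\lVert f\rVert_X<\infty\}$ with the quasinorm $\lVert\cdot\rVert_X$. The quasinorm induces a metrisable topology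 in which $f_n\to f$ iff $\lVert f_n-f\rVert_X\to0$. For topological linear spaces, $X\hookrightarrow Y$ means $X\subseteq Y$ and the identity mapping $X\to Y$ is continuous. *)

theory Defs
  imports "HOL-Analysis.Analysis"
begin

(* The value set C \<union> {\<infinity>}, with None as \<infinity> and the Borel sets of its one-point
   compactification. *)
type_synonym ecomplex = "complex option"

definition ec_borel :: "ecomplex measure" where
  "ec_borel = sigma UNIV {U. openin (Alexandroff_compactification euclidean) U}"

definition ec_abs :: "ecomplex \<Rightarrow> ennreal" where
  "ec_abs z = (case z of None \<Rightarrow> \<infinity> | Some c \<Rightarrow> ennreal (norm c))"

definition ec_of_ennreal :: "ennreal \<Rightarrow> ecomplex" where
  "ec_of_ennreal t = (if t = \<infinity> then None else Some (complex_of_real (enn2real t)))"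

definition ec_scale :: "complex \<Rightarrow> ecomplex \<Rightarrow> ecomplex" where
  "ec_scale a z = (if a = 0 then Some 0 else map_option (\<lambda>c. a * c) z)"

(* A difference involving \<infinity> is set to \<infinity>. This choice is immaterial below: only elements
   of a quasi-Banach function space are subtracted, and these are finite almost everywhere. *)
definition ec_diff :: "ecomplex \<Rightarrow> ecomplex \<Rightarrow> ecomplex" where
  "ec_diff z w = (case (z, w) of (Some c, Some d) \<Rightarrow> Some (c - d) | _ \<Rightarrow> None)"

definition ae_rel :: "'a measure \<Rightarrow> (('a \<Rightarrow> ecomplex) \<times> ('a \<Rightarrow> ecomplex)) set" where
  "ae_rel M = {(f, g). f \<in> measurable M ec_borel \<and> g \<in> measurable M ec_borel \<and>
                       (AE x in M. f x = g x)}"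

(* The elements of M(R,\<mu>) are equivalence classes. *)
definition L0 :: "'a measure \<Rightarrow> ('a \<Rightarrow> ecomplex) set set" where
  "L0 M = measurable M ec_borel // ae_rel M"

definition ae_class :: "'a measure \<Rightarrow> ('a \<Rightarrow> ecomplex) \<Rightarrow> ('a \<Rightarrow> ecomplex) set" where
  "ae_class M f = ae_rel M `` {f}"

definition pos_class :: "'a measure \<Rightarrow> ('a \<Rightarrow> ennreal) \<Rightarrow> ('a \<Rightarrow> ecomplex) set" where
  "pos_class M f = ae_class M (\<lambda>x. ec_of_ennreal (f x))"

definition L0_diff ::
  "'a measure \<Rightarrow> ('a \<Rightarrow> ecomplex) set \<Rightarrow> ('a \<Rightarrow> ecomplex) set \<Rightarrow> ('a \<Rightarrow> ecomplex) set" where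
  "L0_diff M F G = (\<Union>f\<in>F. \<Union>g\<in>G. ae_class M (\<lambda>x. ec_diff (f x) (g x)))"

(* M_+ is represented by the measurable functions into ennreal, through pos_class. Only the
   values of N on L0 M matter. *)
locale quasi_banach_function_norm =
  fixes M :: "'a measure" and N :: "('a \<Rightarrow> ecomplex) set \<Rightarrow> ennreal"
  assumes norm_abs:
    "\<And>f. f \<in> measurable M ec_borel \<Longrightarrow> N (pos_class M (\<lambda>x. ec_abs (f x))) = N (ae_class M f)"
  and Q1a:
    "\<And>a f. f \<in> borel_measurable M \<Longrightarrow>
       N (ae_class M (\<lambda>x. ec_scale a (ec_of_ennreal (f x)))) = ennreal (norm a) * N (pos_class M f)"
  and Q1b:
    "\<And>f. f \<in> borel_measurable M \<Longrightarrow> N (pos_class M f) = 0 \<longleftrightarrow> (AE x in M. f x = 0)"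
  and Q1c:
    "\<exists>C::real. C \<ge> 1 \<and> (\<forall>f\<in>borel_measurable M. \<forall>g\<in>borel_measurable M.
       N (pos_class M (\<lambda>x. f x + g x)) \<le> ennreal C * (N (pos_class M f) + N (pos_class M g)))"
  and P2:
    "\<And>f g. f \<in> borel_measurable M \<Longrightarrow> g \<in> borel_measurable M \<Longrightarrow> (AE x in M. f x \<le> g x) \<Longrightarrow>
       N (pos_class M f) \<le> N (pos_class M g)"
  and P3:
    "\<And>(f :: nat \<Rightarrow> 'a \<Rightarrow> ennreal) g.
       (\<And>n. f n \<in> borel_measurable M) \<Longrightarrow> g \<in> borel_measurable M \<Longrightarrow>
       (AE x in M. incseq (\<lambda>n. f n x) \<and> (\<lambda>n. f n x) \<longlonglongrightarrow> g x) \<Longrightarrow>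
       incseq (\<lambda>n. N (pos_class M (f n))) \<and> (\<lambda>n. N (pos_class M (f n))) \<longlonglongrightarrow> N (pos_class M g)"
  and P4:
    "\<And>E. E \<in> sets M \<Longrightarrow> emeasure M E < \<infinity> \<Longrightarrow> N (pos_class M (indicator E)) < \<infinity>"

definition qbf_space ::
  "'a measure \<Rightarrow> (('a \<Rightarrow> ecomplex) set \<Rightarrow> ennreal) \<Rightarrow> ('a \<Rightarrow> ecomplex) set set" where
  "qbf_space M N = {F \<in> L0 M. N F < \<infinity>}"

(* The balls of a quasinorm need not be open, but by the quasi-triangle inequality each of them
   is a neighbourhood of its centre in this topology. Its convergent sequences are therefore
   exactly those with N (F n - F) \<longrightarrow> 0, and it is the only sequential (in particular, the
   only metrisable) topology with this property. *)
definition qbf_topology ::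
  "'a measure \<Rightarrow> (('a \<Rightarrow> ecomplex) set \<Rightarrow> ennreal) \<Rightarrow> ('a \<Rightarrow> ecomplex) set topology" where
  "qbf_topology M N = topology (\<lambda>U. U \<subseteq> qbf_space M N \<and>
     (\<forall>F\<in>U. \<exists>\<epsilon>>0. \<forall>G\<in>qbf_space M N. N (L0_diff M G F) < \<epsilon> \<longrightarrow> G \<in> U))"

lemma openin_qbf_topology:
  "openin (qbf_topology M N) U \<longleftrightarrow> U \<subseteq> qbf_space M N \<and>
     (\<forall>F\<in>U. \<exists>\<epsilon>>0. \<forall>G\<in>qbf_space M N. N (L0_diff M G F) < \<epsilon> \<longrightarrow> G \<in> U)"
proof -
  have "istopology (\<lambda>U. U \<subseteq> qbf_space M N \<and>
     (\<forall>F\<in>U. \<exists>\<epsilon>>0. \<forall>G\<in>qbf_space M N. N (L0_diff M G F) < \<epsilon> \<longrightarrow> G \<in> U))"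
    (is "istopology ?P")
    unfolding istopology_def
  proof (intro conjI allI impI)
    fix S T assume S: "?P S" and T: "?P T"
    show "S \<inter> T \<subseteq> qbf_space M N" using S by blast
    show "\<forall>F\<in>S \<inter> T. \<exists>\<epsilon>>0. \<forall>G\<in>qbf_space M N. N (L0_diff M G F) < \<epsilon> \<longrightarrow> G \<in> S \<inter> T"
    proof
      fix F assume F: "F \<in> S \<inter> T"
      obtain d where "d > 0" "\<forall>G\<in>qbf_space M N. N (L0_diff M G F) < d \<longrightarrow> G \<in> S"
        using S F by blast
      moreover obtain e where "e > 0" "\<forall>G\<in>qbf_space M N. N (L0_diff M G F) < e \<longrightarrow> G \<in> T"
        using T F by blast
      ultimately show "\<exists>\<epsilon>>0. \<forall>G\<in>qbf_space M N. N (L0_diff M G F) < \<epsilon> \<longrightarrow> G \<in> S \<inter> T"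
        by (intro exI[of _ "min d e"]) auto
    qed
  next
    fix \<K> assume K: "\<forall>K\<in>\<K>. ?P K"
    show "\<Union>\<K> \<subseteq> qbf_space M N" using K by blast
    show "\<forall>F\<in>\<Union>\<K>. \<exists>\<epsilon>>0. \<forall>G\<in>qbf_space M N. N (L0_diff M G F) < \<epsilon> \<longrightarrow> G \<in> \<Union>\<K>"
      using K by (meson UnionE UnionI)
  qed
  then show ?thesis
    by (simp add: qbf_topology_def topology_inverse')
qed

lemma topspace_qbf_topology [simp]: "topspace (qbf_topology M N) = qbf_space M N"
proof
  show "topspace (qbf_topology M N) \<subseteq> qbf_space M N"
    using openin_topspace[of "qbf_topology M N"] unfolding openin_qbf_topology by blast
  have "openin (qbf_topology M N) (qbf_space M N)"
    unfolding openin_qbf_topology by (auto intro: exI[of _ 1])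
  then show "qbf_space M N \<subseteq> topspace (qbf_topology M N)"
    by (rule openin_subset)
qed

definition continuously_embedded :: "'b topology \<Rightarrow> 'b topology \<Rightarrow> bool" where
  "continuously_embedded X Y \<longleftrightarrow> topspace X \<subseteq> topspace Y \<and> continuous_map X Y id"

end

theory Submission
  imports Defs
begin

text \<open>
  Inclusion forces \<open>\<parallel>f\<parallel>\<^sub>Y\<close> to be small whenever \<open>\<parallel>f\<parallel>\<^sub>X\<close> is. Otherwise there are
  \<open>f\<^sub>n \<ge> 0\<close> with \<open>\<parallel>f\<^sub>n\<parallel>\<^sub>Y \<ge> \<epsilon>\<close> and \<open>\<parallel>f\<^sub>n\<parallel>\<^sub>X\<close> so small that, with \<open>C\<close> the modulus of
  concavity of \<open>X\<close>, \<open>\<parallel>(n+1) f\<^sub>n\<parallel>\<^sub>X \<le> (2C)\<^bsup>-n-1\<^esup>\<close>. The quasi-triangle inequality bounds the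
  partial sums of \<open>\<Sum>n. (n+1) f\<^sub>n\<close> in \<open>X\<close>, so by monotone convergence (P3) the sum lies in \<open>X\<close>.
  Its \<open>Y\<close>-quasinorm dominates \<open>(n+1) \<epsilon>\<close> for every \<open>n\<close>, so it is not in \<open>Y\<close>.
\<close>

lemma space_ec_borel [simp]: "space ec_borel = UNIV"
  by (simp add: ec_borel_def)

lemma openin_imp_sets_ec_borel:
  assumes "openin (Alexandroff_compactification euclidean) U"
  shows "U \<in> sets ec_borel"
  unfolding ec_borel_def using assms by (simp add: sigma_sets.Basic)

text \<open>Away from infinity the compactification carries the topology of the plane; compactness
  conditions concern only neighbourhoods of \<open>None\<close>.\<close>

lemma sets_Some_image_ec_borel:
  assumes "open U"
  shows "Some ` U \<in> sets ec_borel"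
  using assms by (intro openin_imp_sets_ec_borel) (auto simp: openin_Alexandroff_compactification)

lemma None_ec_borel: "{None} \<in> sets ec_borel"
proof -
  have "UNIV - range Some \<in> sets ec_borel"
    using sets.compl_sets[OF sets_Some_image_ec_borel[OF open_UNIV]] by simp
  moreover have "UNIV - range Some = {None :: ecomplex}"
    by (auto simp: notin_range_Some)
  ultimately show ?thesis by simp
qed

lemma measurable_Some_ec_borel [measurable]: "Some \<in> borel \<rightarrow>\<^sub>M ec_borel"
  unfolding ec_borel_def
proof (rule measurable_measure_of)
  fix U :: "ecomplex set"
  assume "U \<in> {U. openin (Alexandroff_compactification euclidean) U}"
  then have "open (Some -` U)"
    using openin_continuous_map_preimage[OF continuous_map_Some, of euclidean U]
    by (simp add: vimage_def)
  then show "Some -` U \<inter> space borel \<in> sets borel"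
    by simp
qed auto

text \<open>Turns case distinctions into \<open>if\<close> expressions built from measurable parts.
  The default 0 at \<open>None\<close> is never reached in the rewritten \<open>ec_abs\<close> and
  \<open>ec_diff\<close>.\<close>

definition ec_val :: "ecomplex \<Rightarrow> complex" where
  "ec_val z = (case z of None \<Rightarrow> 0 | Some c \<Rightarrow> c)"

lemma measurable_ec_val [measurable]: "ec_val \<in> ec_borel \<rightarrow>\<^sub>M borel"
proof (rule borel_measurableI)
  fix U :: "complex set"
  assume U: "open U"
  \<comment> \<open>The default value puts \<open>None\<close> into the preimage exactly when 0 lies
    in \<open>U\<close>.\<close>
  have "ec_val -` U \<inter> space ec_borel = Some ` U \<union> (if 0 \<in> U then {None} else {})"
    by (auto simp: ec_val_def split: option.splits)
  also have "\<dots> \<in> sets ec_borel"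
    using sets_Some_image_ec_borel[OF U] None_ec_borel by (intro sets.Un) auto
  finally show "ec_val -` U \<inter> space ec_borel \<in> sets ec_borel" .
qed

lemma pred_eq_None [measurable]: "Measurable.pred ec_borel (\<lambda>z. z = None)"
proof -
  have "{z \<in> space ec_borel. z = None} = {None}" by auto
  then show ?thesis
    unfolding pred_def using None_ec_borel by simp
qed

lemma ec_abs_alt: "ec_abs z = (if z = None then \<infinity> else ennreal (norm (ec_val z)))"
  by (auto simp: ec_abs_def ec_val_def)

lemma measurable_ec_abs [measurable]: "ec_abs \<in> borel_measurable ec_borel"
  unfolding ec_abs_alt by measurable

lemma measurable_None [measurable]: "(\<lambda>_. None) \<in> M \<rightarrow>\<^sub>M ec_borel"
  by (rule measurable_const) simp

lemma measurable_ec_of_ennreal [measurable]: "ec_of_ennreal \<in> borel \<rightarrow>\<^sub>M ec_borel"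
  unfolding ec_of_ennreal_def by measurable

lemma ec_diff_alt:
  "ec_diff z w = (if z = None \<or> w = None then None else Some (ec_val z - ec_val w))"
  by (auto simp: ec_diff_def ec_val_def split: option.splits)

lemma measurable_ec_diff [measurable]:
  assumes [measurable]: "f \<in> M \<rightarrow>\<^sub>M ec_borel" "g \<in> M \<rightarrow>\<^sub>M ec_borel"
  shows "(\<lambda>x. ec_diff (f x) (g x)) \<in> M \<rightarrow>\<^sub>M ec_borel"
  unfolding ec_diff_alt by measurable

lemma equiv_ae_rel: "equiv (M \<rightarrow>\<^sub>M ec_borel) (ae_rel M)"
proof (intro equivI)
  show "ae_rel M \<subseteq> (M \<rightarrow>\<^sub>M ec_borel) \<times> (M \<rightarrow>\<^sub>M ec_borel)"
    by (auto simp: ae_rel_def)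
  show "refl_on (M \<rightarrow>\<^sub>M ec_borel) (ae_rel M)"
    by (auto simp: refl_on_def ae_rel_def)
  show "sym (ae_rel M)"
    by (rule symI) (auto simp: ae_rel_def elim: eventually_mono)
  show "trans (ae_rel M)"
  proof (rule transI)
    fix f g h assume fg: "(f, g) \<in> ae_rel M" and gh: "(g, h) \<in> ae_rel M"
    then have "AE x in M. f x = g x" "AE x in M. g x = h x"
      by (auto simp: ae_rel_def)
    then have "AE x in M. f x = h x" by eventually_elim simp
    then show "(f, h) \<in> ae_rel M" using fg gh by (auto simp: ae_rel_def)
  qed
qed

lemma ae_class_in_L0: "f \<in> M \<rightarrow>\<^sub>M ec_borel \<Longrightarrow> ae_class M f \<in> L0 M"
  by (simp add: ae_class_def L0_def quotientI)

text \<open>The union in \<open>L0_diff\<close> runs over all representatives, but they all give the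
  same class. A difference is thus a class \<open>ae_class M h\<close>, to which
  \<open>norm_abs\<close> applies.\<close>

lemma L0_diff_representative:
  assumes "F \<in> L0 M" "G \<in> L0 M"
  obtains h where "h \<in> M \<rightarrow>\<^sub>M ec_borel" "L0_diff M F G = ae_class M h"
proof -
  obtain f g where f: "f \<in> M \<rightarrow>\<^sub>M ec_borel" "F = ae_rel M `` {f}"
    and g: "g \<in> M \<rightarrow>\<^sub>M ec_borel" "G = ae_rel M `` {g}"
    using assms unfolding L0_def by (auto elim!: quotientE)
  have eq: "ae_class M (\<lambda>x. ec_diff (f' x) (g' x)) = ae_class M (\<lambda>x. ec_diff (f x) (g x))"
    if "f' \<in> F" "g' \<in> G" for f' g'
  proof -
    have *: "f' \<in> M \<rightarrow>\<^sub>M ec_borel" "g' \<in> M \<rightarrow>\<^sub>M ec_borel"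
      and ae: "AE x in M. f x = f' x" "AE x in M. g x = g' x"
      using that f g by (auto simp: ae_rel_def)
    from ae have "AE x in M. ec_diff (f' x) (g' x) = ec_diff (f x) (g x)"
      by eventually_elim simp
    then show ?thesis
      unfolding ae_class_def using * f g
      by (intro equiv_class_eq[OF equiv_ae_rel]) (auto simp: ae_rel_def)
  qed
  \<comment> \<open>The union is nonempty, so it equals the common class.\<close>
  have "f \<in> F" "g \<in> G"
    using f g by (auto simp: ae_rel_def)
  with eq have "L0_diff M F G = ae_class M (\<lambda>x. ec_diff (f x) (g x))"
    unfolding L0_diff_def by blast
  then show thesis
    using f g by (intro that[of "\<lambda>x. ec_diff (f x) (g x)"]) auto
qed

context quasi_banach_function_norm
begin

text \<open>For \<open>0 < a\<close>, scaling by a complex number in \<open>Q1a\<close> agrees with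
  multiplication in \<open>ennreal\<close>, also at infinity, which both leave fixed.\<close>

lemma norm_mult_real:
  assumes "f \<in> borel_measurable M" "0 < a"
  shows "N (pos_class M (\<lambda>x. ennreal a * f x)) = ennreal a * N (pos_class M f)"
proof -
  have "ec_scale (complex_of_real a) (ec_of_ennreal t) = ec_of_ennreal (ennreal a * t)" for t
    using assms(2)
    by (cases t) (auto simp: ec_scale_def ec_of_ennreal_def ennreal_mult_top enn2real_mult
        simp flip: ennreal_mult)
  with Q1a[OF assms(1), of "complex_of_real a"] assms(2) show ?thesis
    by (simp add: pos_class_def)
qed

text \<open>With q = 1/(2C), the quasi-triangle inequality reproduces the bound because C (q^(m+1) +
  q^(m+1)) = q^m. The first term is split off, so the tail starts at m + 1; hence the induction over
  all \<open>m\<close>. The bound does not depend on \<open>k\<close>.\<close>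

lemma norm_sum_geometric_le:
  assumes [measurable]: "\<And>n. f n \<in> borel_measurable M"
    and C: "C \<ge> 1" "\<And>f g. f \<in> borel_measurable M \<Longrightarrow> g \<in> borel_measurable M \<Longrightarrow>
       N (pos_class M (\<lambda>x. f x + g x)) \<le> ennreal C * (N (pos_class M f) + N (pos_class M g))"
    and le: "\<And>n. N (pos_class M (f n)) \<le> ennreal ((1 / (2 * C)) ^ Suc n)"
  shows "N (pos_class M (\<lambda>x. \<Sum>i<k. f (m + i) x)) \<le> ennreal ((1 / (2 * C)) ^ m)"
proof (induction k arbitrary: m)
  case 0
  have "N (pos_class M (\<lambda>x. 0)) = 0"
    by (subst Q1b) auto
  then show ?case by simp
next
  case (Suc k)
  have "N (pos_class M (\<lambda>x. \<Sum>i<Suc k. f (m + i) x))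
      = N (pos_class M (\<lambda>x. f m x + (\<Sum>i<k. f (Suc m + i) x)))"
    by (simp add: sum.lessThan_Suc_shift del: sum.lessThan_Suc)
  also have "\<dots> \<le> ennreal C * (N (pos_class M (f m)) + N (pos_class M (\<lambda>x. \<Sum>i<k. f (Suc m + i) x)))"
    by (intro C(2)) measurable
  also have "\<dots> \<le> ennreal C * (ennreal ((1 / (2 * C)) ^ Suc m) + ennreal ((1 / (2 * C)) ^ Suc m))"
    by (intro mult_left_mono add_mono le Suc.IH) simp
  also have "\<dots> = ennreal ((1 / (2 * C)) ^ m)"
    using C(1) by (simp add: field_simps flip: ennreal_plus ennreal_mult)
  finally show ?case .
qed

end

text \<open>Continuity at zero in epsilon-delta form. Applied to absolute values of differences, it
  yields continuity everywhere.\<close>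

lemma norm_small_of_subset:
  fixes M :: "'a measure"
  assumes X: "quasi_banach_function_norm M NX" and Y: "quasi_banach_function_norm M NY"
    and sub: "qbf_space M NX \<subseteq> qbf_space M NY" and "0 < \<epsilon>"
  shows "\<exists>\<delta>>0. \<forall>f\<in>borel_measurable M. NX (pos_class M f) < \<delta> \<longrightarrow> NY (pos_class M f) < \<epsilon>"
proof (rule ccontr)
  interpret X: quasi_banach_function_norm M NX by fact
  interpret Y: quasi_banach_function_norm M NY by fact
  assume "\<not> ?thesis"
  then have *: "\<exists>f\<in>borel_measurable M. NX (pos_class M f) < \<delta> \<and> \<epsilon> \<le> NY (pos_class M f)"
    if "\<delta> > 0" for \<delta>
    using that by (meson linorder_not_less)
  obtain C where C: "C \<ge> 1" "\<And>f g. f \<in> borel_measurable M \<Longrightarrow> g \<in> borel_measurable M \<Longrightarrow>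
       NX (pos_class M (\<lambda>x. f x + g x)) \<le> ennreal C * (NX (pos_class M f) + NX (pos_class M g))"
    using X.Q1c by blast
  \<comment> \<open>The divisor \<open>Suc n\<close> compensates for the factor \<open>Suc n\<close>
    in \<open>g\<close> below.\<close>
  have "\<exists>f\<in>borel_measurable M.
      NX (pos_class M f) < ennreal ((1 / (2 * C)) ^ Suc n / Suc n) \<and> \<epsilon> \<le> NY (pos_class M f)" for n
    using C(1) by (intro *) (auto simp: ennreal_less_zero_iff)
  then obtain f where f [measurable]: "\<And>n. f n \<in> borel_measurable M"
    and fX: "\<And>n. NX (pos_class M (f n)) < ennreal ((1 / (2 * C)) ^ Suc n / Suc n)"
    and fY: "\<And>n. \<epsilon> \<le> NY (pos_class M (f n))"
    by metis
  define g where "g n x = ennreal (Suc n) * f n x" for n x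
  have g [measurable]: "g n \<in> borel_measurable M" for n
    unfolding g_def by measurable
  have gX: "NX (pos_class M (g n)) \<le> ennreal ((1 / (2 * C)) ^ Suc n)" for n
  proof -
    have "NX (pos_class M (g n)) = ennreal (Suc n) * NX (pos_class M (f n))"
      unfolding g_def by (intro X.norm_mult_real) auto
    also have "\<dots> \<le> ennreal (Suc n) * ennreal ((1 / (2 * C)) ^ Suc n / Suc n)"
      using fX[of n] by (intro mult_left_mono) auto
    also have "\<dots> = ennreal ((1 / (2 * C)) ^ Suc n)"
      using C(1) by (subst ennreal_mult[symmetric]) auto
    finally show ?thesis .
  qed
  \<comment> \<open>Summation in \<open>ennreal\<close> always converges; \<open>s\<close> may a
    priori take the value infinity.\<close>
  define s where "s x = (\<Sum>n. g n x)" for x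
  have s [measurable]: "s \<in> borel_measurable M"
    unfolding s_def by measurable
  have "(\<lambda>k. NX (pos_class M (\<lambda>x. \<Sum>n<k. g n x))) \<longlonglongrightarrow> NX (pos_class M s)"
    unfolding s_def
    by (intro X.P3[THEN conjunct2] AE_I2 conjI)
      (auto intro!: incseq_SucI summable_LIMSEQ)
  moreover have "NX (pos_class M (\<lambda>x. \<Sum>n<k. g n x)) \<le> 1" for k
  proof -
    \<comment> \<open>The case m = 0 of the geometric bound, uniform in \<open>k\<close>.\<close>
    have "NX (pos_class M (\<lambda>x. \<Sum>n<k. g (0 + n) x)) \<le> ennreal ((1 / (2 * C)) ^ 0)"
      by (rule X.norm_sum_geometric_le) (fact g C gX)+
    then show ?thesis by simp
  qed
  ultimately have "NX (pos_class M s) \<le> 1"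
    by (intro LIMSEQ_le_const2) auto
  then have "NX (pos_class M s) < \<infinity>"
    using le_less_trans[OF _ ennreal_one_less_top] by simp
  moreover have "pos_class M s \<in> L0 M"
    unfolding pos_class_def by (intro ae_class_in_L0) measurable
  \<comment> \<open>The inclusion of the spaces enters here: \<open>s\<close> lies in X, hence in
    Y.\<close>
  ultimately have sY: "NY (pos_class M s) < \<infinity>"
    using sub by (auto simp: qbf_space_def)
  have bound: "ennreal (Suc n) * \<epsilon> \<le> NY (pos_class M s)" for n
  proof -
    have "ennreal (Suc n) * \<epsilon> \<le> ennreal (Suc n) * NY (pos_class M (f n))"
      by (intro mult_left_mono fY) simp
    also have "\<dots> = NY (pos_class M (g n))"
      unfolding g_def by (intro Y.norm_mult_real[symmetric]) auto
    \<comment> \<open>A single term of a nonnegative series is at most its sum.\<close>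
    also have "\<dots> \<le> NY (pos_class M s)"
      using sum_le_suminf[of "\<lambda>n. g n x" "{n}" for x]
      by (intro Y.P2 AE_I2) (auto simp: s_def)
    finally show ?thesis .
  qed
  \<comment> \<open>The bound for n = 0 makes \<epsilon> finite, so dividing by it is legitimate and
    the Archimedean property gives the contradiction.\<close>
  have "\<epsilon> < \<infinity>"
    using bound[of 0] sY by (simp add: le_less_trans)
  then have "NY (pos_class M s) / \<epsilon> < top"
    using sY \<open>0 < \<epsilon>\<close> by (auto simp: ennreal_divide_eq_top_iff simp flip: less_top)
  then obtain n where "NY (pos_class M s) / \<epsilon> < of_nat n"
    using ennreal_Ex_less_of_nat by blast
  then have "NY (pos_class M s) < of_nat n * \<epsilon>"
    using \<open>0 < \<epsilon>\<close> \<open>\<epsilon> < \<infinity>\<close> by (subst (asm) divide_less_ennreal) auto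
  also have "\<dots> \<le> ennreal (Suc n) * \<epsilon>"
    by (intro mult_right_mono) (auto simp flip: ennreal_of_nat_eq_real_of_nat)
  finally show False using bound[of n] by simp
qed

theorem corollary3p10:
  fixes M :: "'a measure"
    and NX NY :: "('a \<Rightarrow> ecomplex) set \<Rightarrow> ennreal"
  assumes "sigma_finite_measure M"
    and "quasi_banach_function_norm M NX"
    and "quasi_banach_function_norm M NY"
    and "qbf_space M NX \<subseteq> qbf_space M NY"
  shows "continuously_embedded (qbf_topology M NX) (qbf_topology M NY)"
proof -
  interpret X: quasi_banach_function_norm M NX by fact
  interpret Y: quasi_banach_function_norm M NY by fact
  have "openin (qbf_topology M NX) {F \<in> qbf_space M NX. F \<in> U}"
    if U: "openin (qbf_topology M NY) U" for U
    unfolding openin_qbf_topology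
  proof (intro conjI ballI)
    fix F assume F: "F \<in> {F \<in> qbf_space M NX. F \<in> U}"
    then obtain \<epsilon> where \<epsilon>: "\<epsilon> > 0" "\<And>G. G \<in> qbf_space M NY \<Longrightarrow> NY (L0_diff M G F) < \<epsilon> \<Longrightarrow> G \<in> U"
      using U unfolding openin_qbf_topology by blast
    obtain \<delta> where \<delta>: "\<delta> > 0"
      "\<And>f. f \<in> borel_measurable M \<Longrightarrow> NX (pos_class M f) < \<delta> \<Longrightarrow> NY (pos_class M f) < \<epsilon>"
      using norm_small_of_subset[OF assms(2-4) \<epsilon>(1)] by blast
    have "G \<in> U" if G: "G \<in> qbf_space M NX" and less: "NX (L0_diff M G F) < \<delta>" for G
    proof -
      \<comment> \<open>Both quasinorms of the difference equal those of the same function |h|, so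
        smallness passes from X to Y.\<close>
      obtain h where h [measurable]: "h \<in> M \<rightarrow>\<^sub>M ec_borel" and diff: "L0_diff M G F = ae_class M h"
        using F G by (auto simp: qbf_space_def elim: L0_diff_representative)
      have "NY (pos_class M (\<lambda>x. ec_abs (h x))) < \<epsilon>"
        using less X.norm_abs[OF h] by (intro \<delta>(2)) (auto simp: diff)
      then show ?thesis
        using G assms(4) Y.norm_abs[OF h] by (intro \<epsilon>(2)) (auto simp: diff)
    qed
    with \<delta>(1) show "\<exists>\<delta>>0. \<forall>G\<in>qbf_space M NX. NX (L0_diff M G F) < \<delta> 
        \<longrightarrow> G \<in> {F \<in> qbf_space M NX. F \<in> U}"
      by blast
  qed auto
  then show ?thesis
    using assms(4) by (auto simp: continuously_embedded_def continuous_map_def)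
qed

end
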